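(* For all $n$ and all $k\ge3$, $$|\mathcal S_n(132,\,12\cdots k)|=|\mathcal S_n(132,\,23\cdots k1)|=|\mathcal S_n(132,\,k12\cdots(k-1))|.$$
   Context: $\mathcal S_n(\tau_1,\tau_2)$ is the set of permutations $\pi=\pi_1\cdots\pi_n$ of $\{1,\dots,n\}$ avoiding both patterns $\tau_1$ and $\tau_2$, where $\pi$ avoids $\tau\in\mathcal S_k$ if there are no $i_1<\dots<i_k$ such that $\pi_{i_1}\cdots\pi_{i_k}$ is in the same relative order as $\tau_1\cdots\tau_k$. The patterns, as words of length $k$, are $1,2,\dots,k$; $2,3,\dots,k,1$; and $k,1,2,\dots,k-1$. *)

theory Defs
  imports "HOL-Combinatorics.Combinatorics"
begin

text \<open>
  Permutations of \<open>{1..n}\<close> are in one-line notation, as elements of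
  \<open>permutations_of_set {1..n}\<close>. List positions count from 0, entries from 1.
\<close>

definition contains_pattern :: "nat list \<Rightarrow> nat list \<Rightarrow> bool" where
  "contains_pattern \<pi> \<tau> \<longleftrightarrow>
     (\<exists>i :: nat \<Rightarrow> nat.
        strict_mono_on {..<length \<tau>} i \<and>
        (\<forall>a<length \<tau>. i a < length \<pi>) \<and>
        (\<forall>a<length \<tau>. \<forall>b<length \<tau>. \<pi> ! i a < \<pi> ! i b \<longleftrightarrow> \<tau> ! a < \<tau> ! b))"

definition avoids :: "nat list \<Rightarrow> nat list \<Rightarrow> bool" where
  "avoids \<pi> \<tau> \<longleftrightarrow> \<not> contains_pattern \<pi> \<tau>"

definition avoiders :: "nat \<Rightarrow> nat list \<Rightarrow> nat list \<Rightarrow> nat list set" where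
  "avoiders n \<tau>\<^sub>1 \<tau>\<^sub>2 =
     {\<pi> \<in> permutations_of_set {1..n}. avoids \<pi> \<tau>\<^sub>1 \<and> avoids \<pi> \<tau>\<^sub>2}"

end

theory Submission
  imports Defs "HOL-Library.Sublist" "HOL-Computational_Algebra.Formal_Power_Series"
begin

text \<open>
  Cut a 132-avoiding permutation at its maximum, \<open>\<pi> = L m R\<close>. Every entry of \<open>L\<close> exceeds every
  entry of \<open>R\<close>, since \<open>x < y\<close> with \<open>x\<close> in \<open>L\<close> and \<open>y\<close> in \<open>R\<close> would make \<open>x m y\<close> a 132. Conversely any
  two 132-avoiders can be put together in this way (\<open>glue\<close>), so sets of 132-avoiders can be counted
  recursively over the size of the left part (\<open>card_by_glue\<close>).

  How an occurrence of one of the three patterns can sit across the cut is very restricted, as an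
  ascent can never go from \<open>L\<close> to \<open>R\<close> and \<open>m\<close> can only play the largest letter. For \<open>k \<ge> 3\<close>:
  \<^item> \<open>L m R\<close> avoids \<open>1 2 \<dots> k\<close> iff \<open>L\<close> avoids \<open>1 2 \<dots> (k - 1)\<close> and \<open>R\<close> avoids \<open>1 2 \<dots> k\<close>;
  \<^item> \<open>L m R\<close> avoids \<open>k 1 2 \<dots> (k - 1)\<close> iff \<open>L\<close> does and \<open>R\<close> avoids \<open>1 2 \<dots> (k - 1)\<close>;
  \<^item> \<open>L m R\<close> avoids \<open>2 3 \<dots> k 1\<close> iff \<open>L\<close> and \<open>R\<close> do and, unless \<open>R\<close> is empty, \<open>L\<close> avoids
    \<open>1 2 \<dots> (k - 2)\<close>; in a nonempty \<open>R\<close> any entry serves as the final 1, and \<open>m\<close> as the \<open>k\<close>.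

  Let \<open>F\<^sub>k\<close>, \<open>H\<^sub>k\<close>, \<open>G\<^sub>k\<close> be the generating functions of the three families, in this order. The
  recursions say \<open>F\<^sub>k = 1 + X F\<^sub>k\<^sub>-\<^sub>1 F\<^sub>k\<close>, \<open>H\<^sub>k = 1 + X H\<^sub>k F\<^sub>k\<^sub>-\<^sub>1\<close> and
  \<open>G\<^sub>k = 1 + X (G\<^sub>k + F\<^sub>k\<^sub>-\<^sub>2 (G\<^sub>k - 1))\<close>. The first two make \<open>F\<^sub>k\<close> and \<open>H\<^sub>k\<close> inverses of
  \<open>1 - X F\<^sub>k\<^sub>-\<^sub>1\<close>. The third reads \<open>G\<^sub>k (1 - X F\<^sub>k\<^sub>-\<^sub>2 - X) = 1 - X F\<^sub>k\<^sub>-\<^sub>2\<close>; multiplied by \<open>F\<^sub>k\<^sub>-\<^sub>1\<close>, the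
  inverse of \<open>1 - X F\<^sub>k\<^sub>-\<^sub>2\<close>, it makes \<open>G\<^sub>k\<close> an inverse of \<open>1 - X F\<^sub>k\<^sub>-\<^sub>1\<close> as well. So all three agree.
\<close>

section \<open>Pattern containment through subsequences\<close>

text \<open>
  Position maps are awkward to cut at the maximum, whereas a subsequence of an append splits into
  two subsequences; so all containments below are phrased with \<open>subseq\<close>.
\<close>

lemma contains_pattern_iff_subseq:
  "contains_pattern \<pi> \<tau> \<longleftrightarrow>
     (\<exists>s. subseq s \<pi> \<and> length s = length \<tau> \<and>
          (\<forall>a<length \<tau>. \<forall>b<length \<tau>. s ! a < s ! b \<longleftrightarrow> \<tau> ! a < \<tau> ! b))"
  (is "_ \<longleftrightarrow> (\<exists>s. ?P s)")
proof
  assume "contains_pattern \<pi> \<tau>"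
  then obtain i where i: "strict_mono_on {..<length \<tau>} i" "\<forall>a<length \<tau>. i a < length \<pi>"
    "\<forall>a<length \<tau>. \<forall>b<length \<tau>. \<pi> ! i a < \<pi> ! i b \<longleftrightarrow> \<tau> ! a < \<tau> ! b"
    unfolding contains_pattern_def by blast
  define idx where "idx = map i [0..<length \<tau>]"
  have "sorted_wrt (<) idx"
    using i(1) by (auto simp: idx_def sorted_wrt_iff_nth_less strict_mono_on_def)
  moreover have "set idx \<subseteq> set [0..<length \<pi>]"
    using i(2) by (auto simp: idx_def)
  ultimately have "subseq idx [0..<length \<pi>]"
    by (intro sorted_subset_imp_subseq) (auto simp: strict_sorted_iff)
  then have "subseq (map ((!) \<pi>) idx) (map ((!) \<pi>) [0..<length \<pi>])"
    by (rule subseq_map)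
  then have "?P (map ((!) \<pi>) idx)"
    using i(3) by (simp add: map_nth idx_def)
  then show "\<exists>s. ?P s" ..
next
  assume "\<exists>s. ?P s"
  then obtain s where s: "?P s" ..
  then obtain N where N: "s = nths \<pi> N"
    by (auto simp: subseq_conv_nths)
  define idx where "idx = nths [0..<length \<pi>] N"
  have s_eq: "s = map ((!) \<pi>) idx"
    unfolding N idx_def by (simp add: nths_map[symmetric] map_nth)
  have "sorted idx" "distinct idx"
    unfolding idx_def by (simp_all add: sorted_nths)
  then have "sorted_wrt (<) idx"
    by (simp add: strict_sorted_iff)
  moreover have "set idx \<subseteq> {..<length \<pi>}"
    unfolding idx_def using set_nths_subset by fastforce
  moreover have "length idx = length \<tau>"
    using s s_eq by simp
  ultimately show "contains_pattern \<pi> \<tau>"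
    unfolding contains_pattern_def using s s_eq
    by (intro exI[of _ "(!) idx"])
       (auto simp: strict_mono_on_def sorted_wrt_iff_nth_less subset_iff)
qed

lemma contains_pattern_map_strict_mono:
  assumes "strict_mono f"
  shows "contains_pattern (map f \<pi>) \<tau> \<longleftrightarrow> contains_pattern \<pi> \<tau>"
  unfolding contains_pattern_def
  by (intro ex_cong1) (auto simp: strict_mono_less[OF assms])

definition increasing :: "nat \<Rightarrow> nat list" where
  "increasing k = [1..<k + 1]"

definition increasing_then_min :: "nat \<Rightarrow> nat list" where
  "increasing_then_min k = [2..<k + 1] @ [1]"

definition max_then_increasing :: "nat \<Rightarrow> nat list" where
  "max_then_increasing k = k # [1..<k]"

lemma contains_132_iff:
  "contains_pattern \<pi> [1, 3, 2] \<longleftrightarrow> (\<exists>a b c. subseq [a, b, c] \<pi> \<and> a < c \<and> c < b)"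
proof -
  have *: "(\<forall>i<length [1, 3, 2 :: nat]. \<forall>j<length [1, 3, 2 :: nat].
            [a, b, c] ! i < [a, b, c] ! j \<longleftrightarrow> [1, 3, 2 :: nat] ! i < [1, 3, 2] ! j)
          \<longleftrightarrow> a < c \<and> c < b" for a b c :: nat
    by (auto simp: All_less_Suc numeral_3_eq_3)
  show ?thesis
    unfolding contains_pattern_iff_subseq
  proof (intro iffI; elim exE conjE)
    fix s assume "subseq s \<pi>" "length s = length [1, 3, 2 :: nat]"
      "\<forall>a<length [1, 3, 2 :: nat]. \<forall>b<length [1, 3, 2 :: nat]. 
         s ! a < s ! b \<longleftrightarrow> [1, 3, 2 :: nat] ! a < [1, 3, 2] ! b"
    moreover from this(2) obtain a b c where "s = [a, b, c]"
      by (auto simp: length_Suc_conv)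
    ultimately show "\<exists>a b c. subseq [a, b, c] \<pi> \<and> a < c \<and> c < b"
      using *[of a b c] by blast
  next
    fix a b c assume "subseq [a, b, c] \<pi>" "a < c" "c < b"
    then show "\<exists>s. subseq s \<pi> \<and> length s = length [1, 3, 2 :: nat] \<and>
      (\<forall>a<length [1, 3, 2 :: nat]. \<forall>b<length [1, 3, 2 :: nat].
         s ! a < s ! b \<longleftrightarrow> [1, 3, 2 :: nat] ! a < [1, 3, 2] ! b)"
      using *[of a b c] by (intro exI[of _ "[a, b, c]"]) simp
  qed
qed

lemma sorted_wrt_less_nth_iff:
  assumes "sorted_wrt (<) (s :: nat list)" "a < length s" "b < length s"
  shows "s ! a < s ! b \<longleftrightarrow> a < b"
  using assms sorted_wrt_nth_less[OF assms(1), of a b] sorted_wrt_nth_less[OF assms(1), of b a]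
  by (cases a b rule: linorder_cases) auto

lemma contains_increasing_iff:
  "contains_pattern \<pi> (increasing k) \<longleftrightarrow>
     (\<exists>s. subseq s \<pi> \<and> length s = k \<and> sorted_wrt (<) s)"
proof -
  have "(\<forall>a<k. \<forall>b<k. s ! a < s ! b \<longleftrightarrow> increasing k ! a < increasing k ! b) \<longleftrightarrow>
        sorted_wrt (<) s" if "length s = k" for s :: "nat list"
    using that sorted_wrt_less_nth_iff[of s]
    by (auto simp: increasing_def sorted_wrt_iff_nth_less simp del: upt_Suc)
  then show ?thesis
    unfolding contains_pattern_iff_subseq by (auto simp: increasing_def simp del: upt_Suc)
qed

lemma contains_increasing_then_min_iff:
  "contains_pattern \<pi> (increasing_then_min (Suc k)) \<longleftrightarrow>
     (\<exists>s x. subseq (s @ [x]) \<pi> \<and> length s = k \<and> sorted_wrt (<) s \<and> (\<forall>y\<in>set s. x < y))"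
proof -
  let ?\<tau> = "increasing_then_min (Suc k)"
  have len: "length ?\<tau> = Suc k"
    by (simp add: increasing_then_min_def del: upt_Suc)
  have nth: "?\<tau> ! a = (if a = k then 1 else a + 2)" if "a < Suc k" for a
    using that by (auto simp: increasing_then_min_def nth_append simp del: upt_Suc)
  have *: "(\<forall>a<Suc k. \<forall>b<Suc k. (s @ [x]) ! a < (s @ [x]) ! b \<longleftrightarrow> ?\<tau> ! a < ?\<tau> ! b)
          \<longleftrightarrow> sorted_wrt (<) s \<and> (\<forall>y\<in>set s. x < y)" (is "?l \<longleftrightarrow> ?r") if "length s = k" for s :: "nat list" and x
  proof
    assume l: ?l
    have "s ! a < s ! b \<longleftrightarrow> a < b" if "a < k" "b < k" for a b
      using l[rule_format, of a b] that \<open>length s = k\<close> by (simp add: nth nth_append)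
    moreover have "x < s ! a" if "a < k" for a
      using l[rule_format, of k a] that \<open>length s = k\<close> by (simp add: nth nth_append)
    ultimately show ?r
      using \<open>length s = k\<close> by (auto simp: sorted_wrt_iff_nth_less in_set_conv_nth)
  next
    assume r: ?r
    then have "x < s ! a" if "a < k" for a
      using that \<open>length s = k\<close> by simp
    then show ?l
      using r \<open>length s = k\<close> sorted_wrt_less_nth_iff[of s]
      by (auto simp: nth nth_append less_Suc_eq not_less less_imp_le)
  qed
  show ?thesis
    unfolding contains_pattern_iff_subseq len
  proof (intro iffI; elim exE conjE)
    fix s assume "subseq s \<pi>" "length s = Suc k"
      "\<forall>a<Suc k. \<forall>b<Suc k. s ! a < s ! b \<longleftrightarrow> ?\<tau> ! a < ?\<tau> ! b"
    moreover from this(2) obtain t x where "s = t @ [x]" "length t = k"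
      by (metis length_append_singleton length_Suc_conv_rev nat.inject)
    ultimately show "\<exists>s x. subseq (s @ [x]) \<pi> \<and> length s = k \<and> sorted_wrt (<) s \<and> (\<forall>y\<in>set s. x < y)"
      using *[of t x] by blast
  next
    fix s x assume "subseq (s @ [x]) \<pi>" "length s = k" "sorted_wrt (<) s" "\<forall>y\<in>set s. x < y"
    then show "\<exists>s. subseq s \<pi> \<and> length s = Suc k \<and>
      (\<forall>a<Suc k. \<forall>b<Suc k. s ! a < s ! b \<longleftrightarrow> ?\<tau> ! a < ?\<tau> ! b)"
      using *[of s x] by (intro exI[of _ "s @ [x]"]) simp
  qed
qed

lemma contains_max_then_increasing_iff:
  "contains_pattern \<pi> (max_then_increasing (Suc k)) \<longleftrightarrow>
     (\<exists>x s. subseq (x # s) \<pi> \<and> length s = k \<and> sorted_wrt (<) s \<and> (\<forall>y\<in>set s. y < x))"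
proof -
  let ?\<tau> = "max_then_increasing (Suc k)"
  have len: "length ?\<tau> = Suc k"
    by (simp add: max_then_increasing_def del: upt_Suc)
  have nth: "?\<tau> ! a = (if a = 0 then Suc k else a)" if "a < Suc k" for a
    using that by (auto simp: max_then_increasing_def nth_Cons' simp del: upt_Suc)
  have *: "(\<forall>a<Suc k. \<forall>b<Suc k. (x # s) ! a < (x # s) ! b \<longleftrightarrow> ?\<tau> ! a < ?\<tau> ! b)
          \<longleftrightarrow> sorted_wrt (<) s \<and> (\<forall>y\<in>set s. y < x)" (is "?l \<longleftrightarrow> ?r") if "length s = k" for s :: "nat list" and x
  proof
    assume l: ?l
    have "s ! a < s ! b \<longleftrightarrow> a < b" if "a < k" "b < k" for a b
      using l[rule_format, of "Suc a" "Suc b"] that by (simp add: nth)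
    moreover have "s ! a < x" if "a < k" for a
      using l[rule_format, of "Suc a" 0] that by (simp add: nth)
    ultimately show ?r
      using \<open>length s = k\<close> by (auto simp: sorted_wrt_iff_nth_less in_set_conv_nth)
  next
    assume r: ?r
    then have "s ! a < x" if "a < k" for a
      using that \<open>length s = k\<close> by simp
    then show ?l
      using r \<open>length s = k\<close> sorted_wrt_less_nth_iff[of s]
      by (auto simp: nth nth_Cons' not_less less_imp_le)
  qed
  show ?thesis
    unfolding contains_pattern_iff_subseq len
  proof (intro iffI; elim exE conjE)
    fix s assume "subseq s \<pi>" "length s = Suc k"
      "\<forall>a<Suc k. \<forall>b<Suc k. s ! a < s ! b \<longleftrightarrow> ?\<tau> ! a < ?\<tau> ! b"
    moreover from this(2) obtain x t where "s = x # t" "length t = k"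
      by (auto simp: length_Suc_conv)
    ultimately show "\<exists>x s. subseq (x # s) \<pi> \<and> length s = k \<and> sorted_wrt (<) s \<and> (\<forall>y\<in>set s. y < x)"
      using *[of t x] by blast
  next
    fix s x assume "subseq (x # s) \<pi>" "length s = k" "sorted_wrt (<) s" "\<forall>y\<in>set s. y < x"
    then show "\<exists>s. subseq s \<pi> \<and> length s = Suc k \<and>
      (\<forall>a<Suc k. \<forall>b<Suc k. s ! a < s ! b \<longleftrightarrow> ?\<tau> ! a < ?\<tau> ! b)"
      using *[of s x] by (intro exI[of _ "x # s"]) simp
  qed
qed

lemma contains_increasing_mono:
  assumes "contains_pattern \<pi> (increasing k)" "j \<le> k"
  shows "contains_pattern \<pi> (increasing j)"
proof -
  from assms(1) obtain s where s: "subseq s \<pi>" "length s = k" "sorted_wrt (<) s"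
    by (auto simp: contains_increasing_iff)
  have "subseq (take j s) \<pi>"
    using s(1) subseq_order.trans[OF prefix_imp_subseq[OF take_is_prefix]] by blast
  then show ?thesis
    unfolding contains_increasing_iff using s assms(2)
    by (intro exI[of _ "take j s"]) (auto simp: sorted_wrt_take)
qed

section \<open>Containment across the maximum\<close>

text \<open>
  The situation around the maximum \<open>m\<close> of a 132-avoiding list \<open>L @ m # R\<close>.
\<close>

locale max_split =
  fixes L R :: "nat list" and m :: nat
  assumes left_less_max: "x \<in> set L \<Longrightarrow> x < m"
    and right_less_max: "y \<in> set R \<Longrightarrow> y < m"
    and right_less_left: "x \<in> set L \<Longrightarrow> y \<in> set R \<Longrightarrow> y < x"
begin

text \<open>
  Besides the two pieces of a subsequence, both cases supply the order relations between them, because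
  these alone decide which letters of a pattern may lie on which side.
\<close>

lemma subseqE:
  assumes "subseq s (L @ m # R)"
  obtains (skip_max) s1 s2 where "s = s1 @ s2" "subseq s1 L" "subseq s2 R"
      "\<forall>x\<in>set s1. x < m" "\<forall>y\<in>set s2. y < m" "\<forall>x\<in>set s1. \<forall>y\<in>set s2. y < x"
  | (use_max) s1 s2 where "s = s1 @ m # s2" "subseq s1 L" "subseq s2 R"
      "\<forall>x\<in>set s1. x < m" "\<forall>y\<in>set s2. y < m" "\<forall>x\<in>set s1. \<forall>y\<in>set s2. y < x"
proof -
  from assms obtain s1 s2 where s: "s = s1 @ s2" "subseq s1 L" "subseq s2 (m # R)"
    by (auto simp: subseq_append_iff)
  have sub: "set t \<subseteq> set u" if "subseq t u" for t u :: "nat list"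
    using list_emb_set[OF that] by auto
  show ?thesis
  proof (cases "subseq s2 R")
    case True
    show ?thesis
      using s True sub[OF s(2)] sub[OF True] left_less_max right_less_max right_less_left
      by (intro skip_max[of s1 s2] ballI) (auto simp: subset_iff)
  next
    case False
    with s(3) obtain t where t: "s2 = m # t" "subseq t R"
      by (auto elim: list_emb.cases)
    show ?thesis
      using s t sub[OF s(2)] sub[OF t(2)] left_less_max right_less_max right_less_left
      by (intro use_max[of s1 t] ballI) (auto simp: subset_iff)
  qed
qed

lemma contains_left: "contains_pattern L \<tau> \<Longrightarrow> contains_pattern (L @ m # R) \<tau>"
  unfolding contains_pattern_iff_subseq by (blast intro: subseq_rev_drop_many)

lemma contains_right: "contains_pattern R \<tau> \<Longrightarrow> contains_pattern (L @ m # R) \<tau>"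
  unfolding contains_pattern_iff_subseq by (blast intro: subseq_drop_many list_emb_Cons)

text \<open>
  An occurrence \<open>a b c\<close> of 132 inside neither \<open>L\<close> nor \<open>R\<close> would have \<open>a\<close> in \<open>L\<close> and \<open>c > a\<close> in \<open>R\<close>,
  against \<open>right_less_left\<close>; if it used \<open>m\<close>, it would be as the letter \<open>b\<close>.
\<close>

lemma contains_132:
  "contains_pattern (L @ m # R) [1, 3, 2] \<longleftrightarrow>
     contains_pattern L [1, 3, 2] \<or> contains_pattern R [1, 3, 2]"
proof
  assume "contains_pattern (L @ m # R) [1, 3, 2]"
  then obtain a b c where abc: "subseq [a, b, c] (L @ m # R)" "a < c" "c < b"
    unfolding contains_132_iff by blast
  from abc(1) show "contains_pattern L [1, 3, 2] \<or> contains_pattern R [1, 3, 2]"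
  proof (cases rule: subseqE)
    case (skip_max s1 s2)
    have "s1 = [] \<or> s2 = []"
      using skip_max abc by (fastforce simp: Cons_eq_append_conv)
    then show ?thesis
      unfolding contains_132_iff using skip_max abc by (metis append.right_neutral append_Nil)
  next
    case (use_max s1 s2)
    then show ?thesis
      using abc by (fastforce simp: Cons_eq_append_conv)
  qed
qed (auto intro: contains_left contains_right)

text \<open>
  An increasing subsequence that starts in \<open>L\<close> cannot enter \<open>R\<close>, but it can always be prolonged
  by \<open>m\<close>, and nothing in \<open>R\<close> can be larger than \<open>m\<close>.
\<close>

lemma contains_increasing:
  "contains_pattern (L @ m # R) (increasing (Suc k)) \<longleftrightarrow>
     contains_pattern L (increasing k) \<or> contains_pattern R (increasing (Suc k))"
proof
  assume "contains_pattern (L @ m # R) (increasing (Suc k))"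
  then obtain s where s: "subseq s (L @ m # R)" "length s = Suc k" "sorted_wrt (<) s"
    by (auto simp: contains_increasing_iff)
  from s(1) show "contains_pattern L (increasing k) \<or> contains_pattern R (increasing (Suc k))"
  proof (cases rule: subseqE)
    case (skip_max s1 s2)
    show ?thesis
    proof (cases "s1 = []")
      case True
      then show ?thesis
        using skip_max s by (auto simp: contains_increasing_iff)
    next
      case False
      then have "s2 = []"
        using skip_max s by (cases s1; cases s2) (auto simp: sorted_wrt_append)
      then have "contains_pattern L (increasing (Suc k))"
        using skip_max s by (auto simp: contains_increasing_iff)
      then show ?thesis
        using contains_increasing_mono by auto
    qed
  next
    case (use_max s1 s2)
    then have "s2 = []"
      using s by (cases s2) (auto simp: sorted_wrt_append)
    then show ?thesis
      using use_max s by (auto simp: contains_increasing_iff sorted_wrt_append)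
  qed
next
  assume "contains_pattern L (increasing k) \<or> contains_pattern R (increasing (Suc k))"
  then show "contains_pattern (L @ m # R) (increasing (Suc k))"
  proof
    assume "contains_pattern L (increasing k)"
    then obtain s where s: "subseq s L" "length s = k" "sorted_wrt (<) s"
      by (auto simp: contains_increasing_iff)
    moreover have "\<forall>x\<in>set s. x < m"
      using list_emb_set[OF s(1)] left_less_max by blast
    ultimately show ?thesis
      unfolding contains_increasing_iff
      by (intro exI[of _ "s @ [m]"])
         (auto simp: sorted_wrt_append intro!: list_emb_append_mono)
  qed (rule contains_right)
qed

text \<open>
  An occurrence of \<open>2 3 \<dots> (k + 2) 1\<close> that meets both \<open>L m\<close> and \<open>R\<close> has its increasing part in \<open>L m\<close>
  and its last letter in \<open>R\<close>. The letter
  \<open>k + 2\<close> may always be taken to be \<open>m\<close>, which leaves an increasing sequence of length \<open>k\<close> for \<open>L\<close>.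
\<close>

lemma contains_increasing_then_min:
  "contains_pattern (L @ m # R) (increasing_then_min (Suc (Suc k))) \<longleftrightarrow>
     contains_pattern L (increasing_then_min (Suc (Suc k)))
     \<or> (R \<noteq> [] \<and> contains_pattern L (increasing k))
     \<or> contains_pattern R (increasing_then_min (Suc (Suc k)))" (is "?l \<longleftrightarrow> ?r")
proof
  assume ?l
  then obtain s x where s: "subseq (s @ [x]) (L @ m # R)" "length s = Suc k"
      "sorted_wrt (<) s" "\<forall>y\<in>set s. x < y"
    by (auto simp: contains_increasing_then_min_iff)
  from s(1) show ?r
  proof (cases rule: subseqE)
    case (skip_max s1 s2)
    consider "s2 = []" | "s1 = []" | t where "s2 = t @ [x]" "s = s1 @ t" "s1 \<noteq> []"
      using skip_max(1) by (cases s2 rule: rev_cases) auto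
    then show ?thesis
    proof cases
      case 1
      then have "subseq (s @ [x]) L"
        using skip_max by simp
      then show ?thesis
        using s by (auto simp: contains_increasing_then_min_iff)
    next
      case 2
      then have "subseq (s @ [x]) R"
        using skip_max by simp
      then show ?thesis
        using s by (auto simp: contains_increasing_then_min_iff)
    next
      case 3
      then have "t = []"
        using skip_max s by (cases s1; cases t) (auto simp: sorted_wrt_append)
      then have "contains_pattern L (increasing (Suc k))"
        using 3 skip_max s by (auto simp: contains_increasing_iff)
      moreover have "R \<noteq> []"
        using 3 skip_max by auto
      ultimately show ?thesis
        using contains_increasing_mono[of L "Suc k" k] by auto
    qed
  next
    case (use_max s1 s2)
    have "s2 \<noteq> []"
    proof
      assume "s2 = []"
      then show False
        using use_max s by (cases s1) auto
    qed
    then obtain t where t: "s2 = t @ [x]" "s = s1 @ m # t"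
      using use_max(1) by (cases s2 rule: rev_cases) auto
    then have "t = []"
      using use_max s by (cases t) (auto simp: sorted_wrt_append)
    then have "contains_pattern L (increasing k)"
      using t use_max s by (auto simp: contains_increasing_iff sorted_wrt_append)
    then show ?thesis
      using t use_max by auto
  qed
next
  assume ?r
  then consider "contains_pattern L (increasing_then_min (Suc (Suc k)))"
    | "contains_pattern R (increasing_then_min (Suc (Suc k)))"
    | "R \<noteq> []" "contains_pattern L (increasing k)"
    by blast
  then show ?l
  proof cases
    case 3
    then obtain s r R' where s: "subseq s L" "length s = k" "sorted_wrt (<) s" and R: "R = r # R'"
      by (auto simp: contains_increasing_iff neq_Nil_conv)
    have sL: "set s \<subseteq> set L"
      using list_emb_set[OF s(1)] by auto
    have "subseq (s @ [m, r]) (L @ m # R)"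
      using s(1) by (auto simp: R intro!: list_emb_append_mono)
    moreover have "\<forall>y\<in>set s. y < m" "\<forall>y\<in>set (s @ [m]). r < y"
      using sL left_less_max right_less_max right_less_left by (auto simp: R)
    ultimately show ?thesis
      unfolding contains_increasing_then_min_iff using s
      by (intro exI[of _ "s @ [m]"] exI[of _ r]) (auto simp: sorted_wrt_append)
  qed (auto intro: contains_left contains_right)
qed

text \<open>
  The maximum itself can be put in front of an increasing subsequence of \<open>R\<close>. Conversely, of an
  occurrence of \<open>(k + 1) 1 2 \<dots> k\<close> that is not inside \<open>L\<close>, the increasing part lies entirely
  in \<open>R\<close>: it does not use \<open>m\<close>, and it cannot pass from \<open>L\<close> to \<open>R\<close>.
\<close>

lemma contains_max_then_increasing:
  "contains_pattern (L @ m # R) (max_then_increasing (Suc k)) \<longleftrightarrow>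
     contains_pattern L (max_then_increasing (Suc k)) \<or> contains_pattern R (increasing k)"
    (is "?l \<longleftrightarrow> ?r")
proof
  assume ?l
  then obtain x s where s: "subseq (x # s) (L @ m # R)" "length s = k"
      "sorted_wrt (<) s" "\<forall>y\<in>set s. y < x"
    by (auto simp: contains_max_then_increasing_iff)
  from s(1) show ?r
  proof (cases rule: subseqE)
    case (skip_max s1 s2)
    consider "s2 = []" | "s1 = []" | t where "s1 = x # t" "s = t @ s2" "s2 \<noteq> []"
      using skip_max(1) by (cases s1) auto
    then show ?thesis
    proof cases
      case 1
      then have "subseq (x # s) L"
        using skip_max by simp
      then show ?thesis
        using s by (auto simp: contains_max_then_increasing_iff)
    next
      case 2
      then have "subseq s R"
        using skip_max by (auto dest: subseq_Cons')
      then show ?thesis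
        using s by (auto simp: contains_increasing_iff)
    next
      case 3
      then have "t = []"
        using skip_max s by (cases t; cases s2) (auto simp: sorted_wrt_append)
      then show ?thesis
        using 3 skip_max s by (auto simp: contains_increasing_iff)
    qed
  next
    case (use_max s1 s2)
    then have "s1 = []"
      using s by (cases s1) auto
    then show ?thesis
      using use_max s by (auto simp: contains_increasing_iff)
  qed
next
  assume ?r
  then show ?l
  proof
    assume "contains_pattern R (increasing k)"
    then obtain s where s: "subseq s R" "length s = k" "sorted_wrt (<) s"
      by (auto simp: contains_increasing_iff)
    have "subseq (m # s) (L @ m # R)"
      using s(1) by (auto intro: subseq_drop_many)
    moreover have "\<forall>y\<in>set s. y < m"
      using list_emb_set[OF s(1)] right_less_max by blast
    ultimately show ?thesis
      unfolding contains_max_then_increasing_iff using s by blast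
  qed (rule contains_left)
qed

end

section \<open>Splitting a 132-avoiding permutation at its maximum\<close>

definition avoiders_132 :: "nat \<Rightarrow> nat list set" where
  "avoiders_132 n = {\<pi> \<in> permutations_of_set {1..n}. avoids \<pi> [1, 3, 2]}"

text \<open>
  The left part is shifted by the length of the right one, so that permutations of \<open>{1..i}\<close>
  and \<open>{1..j}\<close> give a permutation of \<open>{1..Suc (i + j)}\<close>.
\<close>

definition glue :: "nat list \<Rightarrow> nat list \<Rightarrow> nat list" where
  "glue L R = map ((+) (length R)) L @ Suc (length L + length R) # R"

lemma finite_avoiders_132: "finite (avoiders_132 n)"
  unfolding avoiders_132_def by simp

lemma avoiders_132D:
  assumes "\<pi> \<in> avoiders_132 n"
  shows "set \<pi> = {1..n}" "distinct \<pi>" "length \<pi> = n" "\<not> contains_pattern \<pi> [1, 3, 2]"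
  using assms distinct_card[of \<pi>]
  by (auto simp: avoiders_132_def permutations_of_set_def avoids_def)

lemma max_split_glue:
  assumes "set L = {1..i}" "length L = i" "set R = {1..j}" "length R = j"
  shows "max_split (map ((+) (length R)) L) R (Suc (length L + length R))"
  using assms by unfold_locales auto

lemma glue_in_avoiders_132:
  assumes "L \<in> avoiders_132 i" "R \<in> avoiders_132 j"
  shows "glue L R \<in> avoiders_132 (Suc (i + j))"
proof -
  note L = avoiders_132D[OF assms(1)] and R = avoiders_132D[OF assms(2)]
  interpret max_split "map ((+) (length R)) L" R "Suc (length L + length R)"
    by (rule max_split_glue) (use L R in auto)
  have "set (glue L R) = (+) j ` {1..i} \<union> insert (Suc (i + j)) {1..j}"
    using L R by (simp add: glue_def)
  also have "(+) j ` {1..i} = {j + 1..j + i}"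
    by simp
  also have "{j + 1..j + i} \<union> insert (Suc (i + j)) {1..j} = {1..Suc (i + j)}"
    by auto
  finally have "set (glue L R) = {1..Suc (i + j)}" .
  moreover have "distinct (glue L R)"
    using L R by (auto simp: glue_def distinct_map)
  moreover have "\<not> contains_pattern (glue L R) [1, 3, 2]"
    using L R contains_132 contains_pattern_map_strict_mono[of "(+) (length R)" L]
    by (simp add: glue_def strict_mono_def)
  ultimately show ?thesis
    by (simp add: avoiders_132_def permutations_of_set_def avoids_def)
qed

text \<open>
  The values on the two sides of the maximum are thus determined by the lengths of the sides.
\<close>

lemma lower_part_of_interval:
  fixes X Y :: "nat set"
  assumes "X \<union> Y = {1..n}" "\<And>x y. x \<in> X \<Longrightarrow> y \<in> Y \<Longrightarrow> y < x"
  shows "Y = {1..card Y}" "X = {card Y + 1..n}"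
proof -
  have fin: "finite Y"
    using assms(1) by (metis finite_Un finite_atLeastAtMost)
  have disj: "X \<inter> Y = {}"
    using assms(2) by blast
  have "\<exists>m. Y = {1..m}"
  proof (cases "Y = {}")
    case True
    then show ?thesis by (intro exI[of _ 0]) simp
  next
    case False
    have "Y = {1..Max Y}"
    proof (intro equalityI subsetI)
      fix y assume "y \<in> {1..Max Y}"
      moreover have "Max Y \<in> Y" "Max Y \<le> n"
        using False fin assms(1) by auto
      ultimately have "y \<in> X \<union> Y" "y \<notin> X"
        unfolding assms(1) using assms(2)[of y "Max Y"] by auto
      then show "y \<in> Y" by blast
    qed (use fin assms(1) in auto)
    then show ?thesis ..
  qed
  then obtain m where m: "Y = {1..m}" ..
  then show Y: "Y = {1..card Y}" by simp
  have "X = {1..n} - Y"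
    using disj assms(1) by blast
  then show "X = {card Y + 1..n}"
    using Y m by auto
qed

lemma avoiders_132_Suc_split:
  assumes "\<pi> \<in> avoiders_132 (Suc n)"
  obtains i L R where "i \<le> n" "L \<in> avoiders_132 i" "R \<in> avoiders_132 (n - i)" "\<pi> = glue L R"
proof -
  note \<pi> = avoiders_132D[OF assms]
  have "Suc n \<in> set \<pi>"
    using \<pi> by simp
  then obtain U R where split: "\<pi> = U @ Suc n # R"
    by (meson split_list)
  have dist: "distinct U" "distinct R" "set U \<inter> set R = {}" "Suc n \<notin> set U" "Suc n \<notin> set R"
    using \<pi>(2) split by auto
  have "insert (Suc n) (set U \<union> set R) = {1..Suc n}"
    unfolding \<pi>(1)[symmetric] split by simp
  then have "set U \<union> set R = {1..Suc n} - {Suc n}"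
    using dist by blast
  also have "\<dots> = {1..n}"
    by auto
  finally have union: "set U \<union> set R = {1..n}" .
  \<comment> \<open>Otherwise \<open>x\<close>, the maximum, \<open>y\<close> form a 132.\<close>
  have less: "y < x" if "x \<in> set U" "y \<in> set R" for x y
  proof (rule ccontr)
    assume "\<not> y < x"
    moreover have "x \<noteq> y"
      using that dist(3) by blast
    moreover have "y \<in> {1..n}"
      using that union by blast
    moreover from this have "y < Suc n"
      by simp
    moreover have "subseq [x, Suc n, y] \<pi>"
      using that list_emb_append_mono[of "(=)" "[x]" U "[Suc n, y]" "Suc n # R"] split
      by (simp add: subseq_singleton_left)
    ultimately have "contains_pattern \<pi> [1, 3, 2]"
      unfolding contains_132_iff by (intro exI[of _ x] exI[of _ "Suc n"] exI[of _ y]) auto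
    then show False
      using \<pi>(4) by blast
  qed
  define j where "j = length R"
  have "card (set R) = j"
    using dist by (simp add: j_def distinct_card)
  with lower_part_of_interval[OF union less] have sets: "set R = {1..j}" "set U = {j + 1..n}"
    by auto
  define i where "i = length U"
  have "i + j = n"
    using \<pi>(3) split by (simp add: i_def j_def)
  define L where "L = map (\<lambda>x. x - j) U"
  have U: "U = map ((+) j) L"
    unfolding L_def map_map by (rule map_idI[symmetric]) (use sets(2) in auto)
  have "length L = i"
    by (simp add: L_def i_def)
  have "(+) j ` set L = {j + 1..n}"
    using sets(2) unfolding U by simp
  also have "\<dots> = (+) j ` {1..i}"
    using \<open>i + j = n\<close> by (simp add: add.commute)
  finally have "set L = {1..i}"
    unfolding inj_image_eq_iff[OF inj_on_add] .
  moreover have "distinct L"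
    using dist(1) U by (simp add: distinct_map)
  moreover have "\<not> contains_pattern U [1, 3, 2]" and R: "\<not> contains_pattern R [1, 3, 2]"
    using \<pi>(4) unfolding split contains_pattern_iff_subseq
    by (blast intro: subseq_rev_drop_many subseq_drop_many list_emb_Cons)+
  then have "\<not> contains_pattern L [1, 3, 2]"
    unfolding U by (subst (asm) contains_pattern_map_strict_mono) (rule strict_monoI, simp)
  ultimately have "L \<in> avoiders_132 i"
    unfolding avoiders_132_def permutations_of_set_def avoids_def by blast
  moreover have "R \<in> avoiders_132 j"
    unfolding avoiders_132_def permutations_of_set_def avoids_def using sets(1) dist(2) R by blast
  moreover have "\<pi> = glue L R"
    using split U \<open>i + j = n\<close> \<open>length L = i\<close> by (simp add: glue_def j_def)
  moreover have "j = n - i" "i \<le> n"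
    using \<open>i + j = n\<close> by auto
  ultimately show thesis
    using that by blast
qed

lemma glue_inject:
  assumes "L \<in> avoiders_132 i" "R \<in> avoiders_132 (n - i)" "i \<le> n"
    and "L' \<in> avoiders_132 i'" "R' \<in> avoiders_132 (n - i')" "i' \<le> n"
    and "glue L R = glue L' R'"
  shows "i = i'" "L = L'" "R = R'"
proof -
  note L = avoiders_132D[OF assms(1)] and R = avoiders_132D[OF assms(2)]
    and L' = avoiders_132D[OF assms(4)] and R' = avoiders_132D[OF assms(5)]
  have "map ((+) (n - i)) L @ Suc n # R = map ((+) (n - i')) L' @ Suc n # R'"
    using assms(3,6,7) L(3) R(3) L'(3) R'(3) by (simp add: glue_def)
  moreover have "Suc n \<notin> set (map ((+) (n - i)) L)" "Suc n \<notin> set R"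
    using L R assms(3) by auto
  ultimately have eq: "map ((+) (n - i)) L = map ((+) (n - i')) L'" "R = R'"
    by (simp_all add: append_Cons_eq_iff)
  then show "i = i'" "R = R'"
    using L(3) L'(3) by (auto dest: map_eq_imp_length_eq)
  with eq(1) show "L = L'"
    by (simp add: inj_map_eq_map)
qed

text \<open>
  The left and right conditions may depend on the size \<open>i\<close> of the left part; for the pattern
  \<open>2 3 \<dots> k 1\<close> the case of an empty right part, \<open>i = n\<close>, has a condition of its own.
\<close>

lemma card_by_glue:
  assumes "\<And>i L R. i \<le> n \<Longrightarrow> L \<in> avoiders_132 i \<Longrightarrow> R \<in> avoiders_132 (n - i) \<Longrightarrow>
             P (glue L R) \<longleftrightarrow> A i L \<and> B i R"
  shows "card {\<pi> \<in> avoiders_132 (Suc n). P \<pi>} =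
    (\<Sum>i\<le>n. card {L \<in> avoiders_132 i. A i L} * card {R \<in> avoiders_132 (n - i). B i R})"
proof -
  let ?D = "SIGMA i:{..n}. {L \<in> avoiders_132 i. A i L} \<times> {R \<in> avoiders_132 (n - i). B i R}"
  have "bij_betw (\<lambda>(i, L, R). glue L R) ?D {\<pi> \<in> avoiders_132 (Suc n). P \<pi>}"
    unfolding bij_betw_def
  proof (intro conjI equalityI subsetI)
    show "inj_on (\<lambda>(i, L, R). glue L R) ?D"
    proof (rule inj_onI)
      fix p q assume pq: "p \<in> ?D" "q \<in> ?D" and
        eq: "(\<lambda>(i, L, R). glue L R) p = (\<lambda>(i, L, R). glue L R) q"
      obtain i L R i' L' R' where p: "p = (i, L, R)" and q: "q = (i', L', R')"
        by (metis prod_cases3)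
      have "L \<in> avoiders_132 i" "R \<in> avoiders_132 (n - i)" "i \<le> n"
        "L' \<in> avoiders_132 i'" "R' \<in> avoiders_132 (n - i')" "i' \<le> n" "glue L R = glue L' R'"
        using pq eq unfolding p q by simp_all
      note * = glue_inject[OF this]
      show "p = q"
        unfolding p q by (simp only: *(1) *(2) *(3))
    qed
    fix \<pi> assume "\<pi> \<in> {\<pi> \<in> avoiders_132 (Suc n). P \<pi>}"
    then have \<pi>: "\<pi> \<in> avoiders_132 (Suc n)" "P \<pi>"
      by simp_all
    from \<pi>(1) obtain i L R where split: "i \<le> n" "L \<in> avoiders_132 i"
        "R \<in> avoiders_132 (n - i)" "\<pi> = glue L R"
      by (rule avoiders_132_Suc_split)
    then have "(i, L, R) \<in> ?D"
      using assms[OF split(1-3)] \<pi>(2) by simp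
    then show "\<pi> \<in> (\<lambda>(i, L, R). glue L R) ` ?D"
      using split(4) by (intro image_eqI[of _ _ "(i, L, R)"]) simp_all
  next
    fix \<pi> assume "\<pi> \<in> (\<lambda>(i, L, R). glue L R) ` ?D"
    then obtain i L R where split: "i \<le> n" "L \<in> avoiders_132 i" "R \<in> avoiders_132 (n - i)"
        and "A i L" "B i R" "\<pi> = glue L R"
      by auto
    then show "\<pi> \<in> {\<pi> \<in> avoiders_132 (Suc n). P \<pi>}"
      using assms[OF split] glue_in_avoiders_132[OF split(2,3)] by simp
  qed
  then have "card {\<pi> \<in> avoiders_132 (Suc n). P \<pi>} = card ?D"
    by (simp add: bij_betw_same_card)
  also have "\<dots> = (\<Sum>i\<le>n. card {L \<in> avoiders_132 i. A i L} * card {R \<in> avoiders_132 (n - i). B i R})"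
    by (simp add: finite_avoiders_132 card_cartesian_product)
  finally show ?thesis .
qed

section \<open>Generating functions\<close>

unbundle fps_syntax

definition avoiders_gf :: "nat list \<Rightarrow> int fps" where
  "avoiders_gf \<tau> = Abs_fps (\<lambda>n. int (card (avoiders n [1, 3, 2] \<tau>)))"

lemma avoiders_eq: "avoiders n [1, 3, 2] \<tau> = {\<pi> \<in> avoiders_132 n. avoids \<pi> \<tau>}"
  by (auto simp: avoiders_def avoiders_132_def)

lemma avoiders_gf_nth:
  "avoiders_gf \<tau> $ n = int (card {\<pi> \<in> avoiders_132 n. avoids \<pi> \<tau>})"
  by (simp only: avoiders_gf_def avoiders_eq fps_nth_Abs_fps)

lemma avoiders_0: "\<tau> \<noteq> [] \<Longrightarrow> \<tau>' \<noteq> [] \<Longrightarrow> avoiders 0 \<tau> \<tau>' = {[]}"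
  by (auto simp: avoiders_def avoids_def contains_pattern_def)

lemma glue_avoidance:
  assumes "L \<in> avoiders_132 i" "R \<in> avoiders_132 j"
  shows "avoids (glue L R) (increasing (Suc k)) \<longleftrightarrow>
      avoids L (increasing k) \<and> avoids R (increasing (Suc k))"
    and "avoids (glue L R) (increasing_then_min (Suc (Suc k))) \<longleftrightarrow>
      avoids L (increasing_then_min (Suc (Suc k))) \<and>
      (R = [] \<or> avoids L (increasing k)) \<and>
      avoids R (increasing_then_min (Suc (Suc k)))"
    and "avoids (glue L R) (max_then_increasing (Suc k)) \<longleftrightarrow>
      avoids L (max_then_increasing (Suc k)) \<and> avoids R (increasing k)"
proof -
  note L = avoiders_132D[OF assms(1)] and R = avoiders_132D[OF assms(2)]
  interpret max_split "map ((+) (length R)) L" R "Suc (length L + length R)"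
    by (rule max_split_glue) (use L R in auto)
  have shift: "contains_pattern (map ((+) (length R)) L) \<tau> \<longleftrightarrow> contains_pattern L \<tau>" for \<tau>
    by (rule contains_pattern_map_strict_mono) (simp add: strict_mono_def)
  show "avoids (glue L R) (increasing (Suc k)) \<longleftrightarrow>
      avoids L (increasing k) \<and> avoids R (increasing (Suc k))"
    using contains_increasing by (simp add: avoids_def glue_def shift)
  show "avoids (glue L R) (increasing_then_min (Suc (Suc k))) \<longleftrightarrow>
      avoids L (increasing_then_min (Suc (Suc k))) \<and>
      (R = [] \<or> avoids L (increasing k)) \<and>
      avoids R (increasing_then_min (Suc (Suc k)))"
    using contains_increasing_then_min by (auto simp: avoids_def glue_def shift)
  show "avoids (glue L R) (max_then_increasing (Suc k)) \<longleftrightarrow>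
      avoids L (max_then_increasing (Suc k)) \<and> avoids R (increasing k)"
    using contains_max_then_increasing by (simp add: avoids_def glue_def shift)
qed

text \<open>
  For a nonempty right part, this reduces the two conditions on the left part in \<open>glue_avoidance(2)\<close>
  to a single one.
\<close>

lemma avoids_increasing_then_min_if_avoids_increasing:
  assumes "avoids \<pi> (increasing k)"
  shows "avoids \<pi> (increasing_then_min (Suc (Suc k)))"
proof -
  have "contains_pattern \<pi> (increasing k)"
    if "contains_pattern \<pi> (increasing_then_min (Suc (Suc k)))"
  proof -
    from that obtain s x where "subseq (s @ [x]) \<pi>" "length s = Suc k" "sorted_wrt (<) s"
      by (auto simp: contains_increasing_then_min_iff)
    then have "contains_pattern \<pi> (increasing (Suc k))"
      unfolding contains_increasing_iff
      by (meson prefixI prefix_imp_subseq subseq_order.trans)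
    then show ?thesis
      by (rule contains_increasing_mono) simp
  qed
  then show ?thesis
    using assms by (auto simp: avoids_def)
qed

lemma fps_eq_one_plus_X_mult:
  fixes f a b :: "'a :: comm_ring_1 fps"
  assumes "f $ 0 = 1" "\<And>n. f $ Suc n = (\<Sum>i\<le>n. a $ i * b $ (n - i))"
  shows "f = 1 + fps_X * (a * b)"
proof (rule fps_ext)
  fix n show "f $ n = (1 + fps_X * (a * b)) $ n"
  proof (cases n)
    case (Suc m)
    moreover have "(a * b) $ m = f $ Suc m"
      by (simp add: assms(2) fps_mult_nth atLeast0AtMost)
    ultimately show ?thesis by simp
  qed (simp add: assms(1))
qed

lemma increasing_gf:
  "avoiders_gf (increasing (Suc k)) =
     1 + fps_X * (avoiders_gf (increasing k) * avoiders_gf (increasing (Suc k)))"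
proof (rule fps_eq_one_plus_X_mult)
  show "avoiders_gf (increasing (Suc k)) $ 0 = 1"
    by (simp add: avoiders_gf_def avoiders_0 increasing_def del: upt_Suc)
  show "avoiders_gf (increasing (Suc k)) $ Suc n = (\<Sum>i\<le>n. avoiders_gf (increasing k) $ i *
      avoiders_gf (increasing (Suc k)) $ (n - i))" for n
    unfolding avoiders_gf_nth
    by (subst card_by_glue[where A = "\<lambda>_ L. avoids L (increasing k)"
          and B = "\<lambda>_ R. avoids R (increasing (Suc k))"])
       (rule glue_avoidance(1), simp_all)
qed

lemma max_then_increasing_gf:
  "avoiders_gf (max_then_increasing (Suc k)) =
     1 + fps_X * (avoiders_gf (max_then_increasing (Suc k)) * avoiders_gf (increasing k))"
proof (rule fps_eq_one_plus_X_mult)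
  show "avoiders_gf (max_then_increasing (Suc k)) $ 0 = 1"
    by (simp add: avoiders_gf_def avoiders_0 max_then_increasing_def del: upt_Suc)
  show "avoiders_gf (max_then_increasing (Suc k)) $ Suc n =
      (\<Sum>i\<le>n. avoiders_gf (max_then_increasing (Suc k)) $ i * avoiders_gf (increasing k) $ (n - i))" for n
    unfolding avoiders_gf_nth
    by (subst card_by_glue[where A = "\<lambda>_ L. avoids L (max_then_increasing (Suc k))"
          and B = "\<lambda>_ R. avoids R (increasing k)"])
       (rule glue_avoidance(3), simp_all)
qed

text \<open>
  The summand \<open>G\<close> counts the permutations with empty right part; in the product, \<open>G - 1\<close> accounts
  for the nonempty right parts.
\<close>

lemma increasing_then_min_gf:
  fixes k :: nat
  defines "G \<equiv> avoiders_gf (increasing_then_min (Suc (Suc k)))"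
  shows "G = 1 + fps_X * (G + avoiders_gf (increasing k) * (G - 1))"
proof (rule fps_ext)
  let ?\<tau> = "increasing_then_min (Suc (Suc k))" and ?F = "avoiders_gf (increasing k)"
  have G0: "G $ 0 = 1"
    by (simp add: G_def avoiders_gf_def avoiders_0 increasing_then_min_def del: upt_Suc)
  fix n show "G $ n = (1 + fps_X * (G + ?F * (G - 1))) $ n"
  proof (cases n)
    case 0
    then show ?thesis by (simp add: G0)
  next
    case (Suc m)
    have "G $ Suc m = (\<Sum>i\<le>m. int (card {L \<in> avoiders_132 i.
        if i = m then avoids L ?\<tau> else avoids L (increasing k)}) * G $ (m - i))"
      unfolding G_def avoiders_gf_nth
    proof (subst card_by_glue)
      fix i L R assume "i \<le> m" "L \<in> avoiders_132 i" "R \<in> avoiders_132 (m - i)"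
      moreover from this have "R = [] \<longleftrightarrow> i = m"
        using avoiders_132D(3)[of R "m - i"] by auto
      ultimately show "avoids (glue L R) ?\<tau> \<longleftrightarrow>
          (if i = m then avoids L ?\<tau> else avoids L (increasing k)) \<and> avoids R ?\<tau>"
        using glue_avoidance(2)[of L i R "m - i" k]
          avoids_increasing_then_min_if_avoids_increasing[of L k] by auto
    qed simp
    also have "\<dots> = (\<Sum>i<m. ?F $ i * G $ (m - i)) + G $ m"
      by (simp add: lessThan_Suc_atMost[symmetric] G0 avoiders_gf_nth[symmetric] G_def[symmetric])
    also have "(\<Sum>i<m. ?F $ i * G $ (m - i)) = (\<Sum>i<m. ?F $ i * (G - 1) $ (m - i))"
      by (intro sum.cong) auto
    also have "\<dots> = (?F * (G - 1)) $ m"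
      by (simp add: fps_mult_nth atLeast0AtMost lessThan_Suc_atMost[symmetric] G0)
    finally show ?thesis
      by (simp add: Suc)
  qed
qed

lemma one_plus_mult_fixpoint:
  fixes f b x :: "'a :: comm_ring_1"
  assumes "f = 1 + x * (b * f)"
  shows "f * (1 - x * b) = 1"
proof -
  have "f * (1 - x * b) = f - x * (b * f)"
    by (simp add: algebra_simps)
  then show ?thesis
    by (subst (asm) (2) assms) simp
qed

lemma right_inverse_unique:
  fixes s t u :: "'a :: comm_ring_1"
  assumes "s * u = 1" "t * u = 1"
  shows "s = t"
proof -
  have "s = s * (t * u)"
    using assms by simp
  also have "\<dots> = t * (s * u)"
    by (simp add: ac_simps)
  finally show ?thesis
    using assms by simp
qed

text \<open>
  The equation for \<open>g\<close> is linear, \<open>g (1 - x a - x) = 1 - x a\<close>; multiplication by \<open>b\<close>, the inverse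
  of the right-hand side, gives \<open>g (1 - x b) = 1\<close>.
\<close>

lemma shifted_fixpoint:
  fixes g a b x :: "'a :: comm_ring_1"
  assumes b: "b * (1 - x * a) = 1" and g: "g = 1 + x * (g + a * (g - 1))"
  shows "g * (1 - x * b) = 1"
proof -
  have "g * (1 - x * a - x) = g - x * (g + a * (g - 1)) - x * a"
    by (simp add: algebra_simps)
  also have "g - x * (g + a * (g - 1)) = 1"
    by (subst (1) g) simp
  finally have linear: "g * (1 - x * a - x) = 1 - x * a" .
  have "g * (1 - x * b) = g * (b * (1 - x * a) - x * b)"
    using b by simp
  also have "\<dots> = b * (g * (1 - x * a - x))"
    by (simp add: algebra_simps)
  finally show ?thesis
    using b linear by simp
qed

theorem corollary4p8:
  fixes n k :: nat
  assumes "k \<ge> 3"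
  shows "card (avoiders n [1, 3, 2] [1..<k + 1]) = card (avoiders n [1, 3, 2] ([2..<k + 1] @ [1]))
       \<and> card (avoiders n [1, 3, 2] ([2..<k + 1] @ [1])) = card (avoiders n [1, 3, 2] (k # [1..<k]))"
proof -
  obtain j where k: "k = Suc (Suc j)"
    using assms by (metis One_nat_def Suc_le_D Suc_le_mono numeral_3_eq_3)
  define A where "A = avoiders_gf (increasing j)"
  define B where "B = avoiders_gf (increasing (Suc j))"
  define F where "F = avoiders_gf (increasing k)"
  define G where "G = avoiders_gf (increasing_then_min k)"
  define H where "H = avoiders_gf (max_then_increasing k)"
  have B: "B = 1 + fps_X * (A * B)" and F: "F = 1 + fps_X * (B * F)"
    unfolding A_def B_def F_def k by (rule increasing_gf)+
  have H: "H = 1 + fps_X * (H * B)"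
    unfolding B_def H_def k by (rule max_then_increasing_gf)
  have G: "G = 1 + fps_X * (G + A * (G - 1))"
    unfolding A_def G_def k by (rule increasing_then_min_gf)
  have B': "B * (1 - fps_X * A) = 1"
    using B by (rule one_plus_mult_fixpoint)
  have "F * (1 - fps_X * B) = 1"
    using F by (rule one_plus_mult_fixpoint)
  moreover have "G * (1 - fps_X * B) = 1"
    using B' G by (rule shifted_fixpoint)
  moreover have "H * (1 - fps_X * B) = 1"
    using H by (intro one_plus_mult_fixpoint) (simp only: mult.commute[of B])
  ultimately have "F = G" "G = H"
    by (blast intro: right_inverse_unique)+
  then have "F $ n = G $ n" "G $ n = H $ n"
    by simp_all
  then show ?thesis
    by (simp add: F_def G_def H_def avoiders_gf_def increasing_def increasing_then_min_def
        max_then_increasing_def del: upt_Suc)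
qed

end
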